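(* Let $\zeta_3$ be a primitive cube root of unity. Then \[ \sum_{n=0}^\infty\sum_{m=-\infty}^\infty\overline{M}(m,n)\zeta_3^mq^n=\overline{M}_{0,3}(q^3)+q\overline{M}_{1,3}(q^3)+q^2\overline{M}_{2,3}(q^3), \] where \[ \overline{M}_{0,3}(q)=\frac{(q^3;q^3)_\infty^4(q^2;q^2)_\infty}{(q;q)_\infty^2(q^6;q^6)_\infty^2},\quad \overline{M}_{1,3}(q)=-\frac{(q^6;q^6)_\infty(q^3;q^3)_\infty}{(q;q)_\infty},\quad \overline{M}_{2,3}(q)=-2\frac{(q^6;q^6)_\infty^4}{(q^3;q^3)_\infty^2(q^2;q^2)_\infty}. \]
   Context: $(a;q)_\infty=\prod_{k\ge0}(1-aq^k)$. The numbers $\overline{M}(m,n)$ are defined by \[ \sum_{n\ge0}\sum_{m}\overline{M}(m,n)z^mq^n=\frac{(-q;q)_\infty(q;q)_\infty}{(zq;q)_\infty(z^{-1}q;q)_\infty}. \] *)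

theory Defs
  imports "HOL-Computational_Algebra.Formal_Power_Series"
begin

text \<open>Infinite product of formal power series in q, for factors f k with
  f k = 1 + O(q^k) (k \<ge> 1): the n-th coefficient is that of the finite product
  of the factors k = 1..n (later factors do not affect it).\<close>
definition fps_prodinf :: "(nat \<Rightarrow> complex fps) \<Rightarrow> complex fps" where
  "fps_prodinf f = Abs_fps (\<lambda>n. fps_nth (\<Prod>k\<in>{1..n}. f k) n)"

definition qinf :: "nat \<Rightarrow> complex fps" where
  "qinf a = fps_prodinf (\<lambda>k. 1 - fps_X ^ (a * k))"

definition crank_gf :: "complex \<Rightarrow> complex fps" where
  "crank_gf z = fps_prodinf (\<lambda>k. (1 + fps_X ^ k) * (1 - fps_X ^ k) *
      inverse ((1 - fps_const z * fps_X ^ k) * (1 - fps_const (inverse z) * fps_X ^ k)))"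

definition Mbar :: "int \<Rightarrow> nat \<Rightarrow> int" where
  "Mbar = (THE M. \<forall>n. finite {m. M m n \<noteq> 0} \<and>
      (\<forall>z. z \<noteq> 0 \<longrightarrow> fps_nth (crank_gf z) n = (\<Sum>m\<in>{m. M m n \<noteq> 0}. of_int (M m n) * z powi m)))"

definition M03 :: "complex fps" where
  "M03 = qinf 3 ^ 4 * qinf 2 * inverse (qinf 1 ^ 2 * qinf 6 ^ 2)"

definition M13 :: "complex fps" where
  "M13 = - (qinf 6 * qinf 3 * inverse (qinf 1))"

definition M23 :: "complex fps" where
  "M23 = - (2 * qinf 6 ^ 4 * inverse (qinf 3 ^ 2 * qinf 2))"

end

theory Submission
  imports Defs "HOL-Computational_Algebra.Polynomial"
begin

text \<open>
  Write \<open>E\<^sub>a = qinf a\<close>. At a primitive cube root of unity,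
  \<open>(1 - \<zeta> q\<^sup>k) (1 - \<zeta>\<^sup>-\<^sup>1 q\<^sup>k) (1 - q\<^sup>k) = 1 - q\<^sup>3\<^sup>k\<close>, so the generating function is
  \<open>E\<^sub>1 E\<^sub>2 / E\<^sub>3\<close>. By the Jacobi triple product \<open>E\<^sub>1 E\<^sub>2 = \<phi>(-q) \<psi>(q)\<close> is a product of the two theta
  series \<open>\<phi>(-q) = E\<^sub>1\<^sup>2 / E\<^sub>2\<close> and \<open>\<psi>(q) = E\<^sub>2\<^sup>2 / E\<^sub>1\<close>. Splitting their summation indices modulo 3
  writes each of them as a sum of two theta series that are products again, and
  multiplying out gives the three components.
\<close>

unbundle fps_syntax

section \<open>Gaussian binomials and the finite triple product\<close>

lemma choose_two_add: "(m + n) choose 2 = (m choose 2) + (n choose 2) + m * n"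
  by (induction n) (auto simp: numeral_2_eq_2)

text \<open>Taking the q-Pascal rule as definition avoids division, so Gaussian binomials make sense
  over every commutative ring; \<open>qbinom_qfact\<close> recovers the quotient formula.\<close>

fun qbinom :: "'a::comm_ring_1 \<Rightarrow> nat \<Rightarrow> nat \<Rightarrow> 'a" where
  "qbinom q n 0 = 1"
| "qbinom q 0 (Suc k) = 0"
| "qbinom q (Suc n) (Suc k) = qbinom q n (Suc k) + q ^ (n - k) * qbinom q n k"

text \<open>This is the Pochhammer symbol \<open>(q; q)_n\<close>, without the usual division by
  \<open>(1 - q) ^ n\<close>, so that its limit is \<open>qinf\<close>.\<close>

definition qfact :: "'a::comm_ring_1 \<Rightarrow> nat \<Rightarrow> 'a" where
  "qfact q n = (\<Prod>k<n. 1 - q ^ Suc k)"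

lemma qfact_0 [simp]: "qfact q 0 = 1"
  and qfact_Suc: "qfact q (Suc n) = qfact q n * (1 - q ^ Suc n)"
  by (simp_all add: qfact_def)

lemma qbinom_eq_0: "n < k \<Longrightarrow> qbinom q n k = 0"
  by (induction q n k rule: qbinom.induct) auto

lemma qbinom_qfact: "k \<le> n \<Longrightarrow> qbinom q n k * qfact q k * qfact q (n - k) = qfact q n"
proof (induction q n k rule: qbinom.induct)
  case (3 q n k)
  show ?case
  proof (cases "k = n")
    case True
    then show ?thesis
      using 3(2) by (simp add: qbinom_eq_0 qfact_Suc mult.assoc[symmetric])
  next
    case False
    with 3(3) have kn: "Suc k \<le> n" by simp
    have d: "n - k = Suc (n - Suc k)" using kn by simp
    have p: "q ^ (n - k) * q ^ Suc k = q ^ Suc n"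
      using kn by (simp only: power_add[symmetric]) simp
    \<comment> \<open>The two summands of the q-Pascal rule recombine because
      \<open>1 - q^(n+1) = (1 - q^(n-k)) + q^(n-k) * (1 - q^(k+1))\<close>.\<close>
    have "qbinom q (Suc n) (Suc k) * qfact q (Suc k) * qfact q (Suc n - Suc k) =
       qbinom q n (Suc k) * qfact q (Suc k) * qfact q (n - Suc k) * (1 - q ^ (n - k)) +
       q ^ (n - k) * (1 - q ^ Suc k) * (qbinom q n k * qfact q k * qfact q (n - k))"
      by (simp add: qfact_Suc d) (simp add: algebra_simps)
    also have "\<dots> = qfact q n * (1 - q ^ (n - k)) + q ^ (n - k) * (1 - q ^ Suc k) * qfact q n"
      using 3(1)[OF kn] 3(2) kn by simp
    also have "\<dots> = qfact q n * (1 - q ^ (n - k) * q ^ Suc k)"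
      by (simp only: algebra_simps) simp
    finally show ?thesis by (simp only: p qfact_Suc)
  qed
qed auto

text \<open>Multiplying by the last factor \<open>y + x * q ^ n\<close> acts on the coefficients
  exactly as the q-Pascal rule.\<close>

theorem qbinomial_theorem:
  fixes x y q :: "'a::comm_ring_1"
  shows "(\<Prod>k<n. y + x * q ^ k) = (\<Sum>j\<le>n. q ^ (j choose 2) * qbinom q n j * x ^ j * y ^ (n - j))"
proof (induction n)
  case 0
  show ?case by (simp add: numeral_2_eq_2)
next
  case (Suc n)
  let ?t = "\<lambda>n j. q ^ (j choose 2) * qbinom q n j * x ^ j * y ^ (n - j)"
  have step: "?t (Suc n) (Suc j) = y * ?t n (Suc j) + x * q ^ n * ?t n j" if "j \<le> n" for j
  proof (cases "j = n")
    case True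
    then show ?thesis
      by (simp add: qbinom_eq_0 numeral_2_eq_2 power_add mult_ac)
  next
    case False
    with that have "n - j = Suc (n - Suc j)" by simp
    then have y: "y ^ (n - j) = y * y ^ (n - Suc j)" by (metis power_Suc)
    have q: "q ^ (Suc j choose 2) * q ^ (n - j) = q ^ n * q ^ (j choose 2)"
      using that by (simp add: numeral_2_eq_2 add.commute flip: power_add)
    have "?t (Suc n) (Suc j) = y * ?t n (Suc j) +
        q ^ (Suc j choose 2) * q ^ (n - j) * qbinom q n j * x ^ Suc j * y ^ (n - j)"
      by (simp add: y) (simp add: algebra_simps)
    then show ?thesis by (simp only: q) (simp add: mult_ac)
  qed
  \<comment> \<open>The added summand \<open>j = n + 1\<close> vanishes through
    \<open>qbinom_eq_0\<close>, which also makes the truncated exponent \<open>n - j\<close>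
    harmless.\<close>
  have "(\<Sum>j\<le>n. ?t n j) = (\<Sum>j\<le>Suc n. ?t n j)"
    by (simp add: qbinom_eq_0)
  also have "\<dots> = ?t n 0 + (\<Sum>j\<le>n. ?t n (Suc j))"
    by (rule sum.atMost_Suc_shift)
  finally have "y * (\<Sum>j\<le>n. ?t n j) = ?t (Suc n) 0 + (\<Sum>j\<le>n. y * ?t n (Suc j))"
    by (simp add: distrib_left sum_distrib_left mult_ac)
  moreover have "(\<Prod>k<Suc n. y + x * q ^ k) = y * (\<Sum>j\<le>n. ?t n j) + x * q ^ n * (\<Sum>j\<le>n. ?t n j)"
    by (simp add: Suc.IH algebra_simps)
  ultimately have "(\<Prod>k<Suc n. y + x * q ^ k) =
      ?t (Suc n) 0 + (\<Sum>j\<le>n. y * ?t n (Suc j) + x * q ^ n * ?t n j)"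
    by (simp only: sum.distrib sum_distrib_left add.assoc)
  also have "(\<Sum>j\<le>n. y * ?t n (Suc j) + x * q ^ n * ?t n j) = (\<Sum>j\<le>n. ?t (Suc n) (Suc j))"
    by (rule sum.cong[OF refl], rule step[symmetric]) simp
  also have "?t (Suc n) 0 + \<dots> = (\<Sum>j\<le>Suc n. ?t (Suc n) j)"
    by (rule sum.atMost_Suc_shift [symmetric])
  finally show ?case .
qed

text \<open>The \<open>n\<close>-th term of Ramanujan's theta series \<open>f(a, b)\<close>, i.e. \<open>a ^ (n (n + 1) / 2) * b ^ (n (n - 1) / 2)\<close>;
  see \<open>theta_term_altdef\<close>.\<close>
definition theta_term :: "'a::comm_ring_1 \<Rightarrow> 'a \<Rightarrow> int \<Rightarrow> 'a" where
  "theta_term a b n = (a * b) ^ (nat \<bar>n\<bar> choose 2) * (if n \<ge> 0 then a ^ nat n else b ^ nat (- n))"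

text \<open>Matches the summands of the q-binomial theorem at \<open>x = a\<close>,
  \<open>y = q ^ m\<close> with theta terms centred at \<open>j = m\<close>. The two signs of
  \<open>j - m\<close> are separate cases because all exponents are natural numbers.\<close>

lemma theta_term_shift:
  fixes a b :: "'a::comm_ring_1"
  assumes "j \<le> 2 * m"
  defines "q \<equiv> a * b"
  shows "q ^ (m choose 2) * q ^ (m * m) * a ^ m * theta_term a b (int j - int m) =
         q ^ (j choose 2) * a ^ j * (q ^ m) ^ (2 * m - j)"
proof (cases "m \<le> j")
  case True
  then obtain n where n: "j = m + n" using le_Suc_ex by blast
  with assms have "n \<le> m" by simp
  then have "m * m = m * n + m * (2 * m - j)"
    by (simp add: n flip: distrib_left)
  then show ?thesis
    by (simp add: n theta_term_def q_def[symmetric] choose_two_add power_add power_mult mult_ac)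
next
  case False
  then obtain k where k: "m = j + k" by (metis le_Suc_ex nat_le_linear)
  with False have "k > 0" by simp
  have "(k choose 2) + (k choose 2) + k = k * k"
    by (induction k) (auto simp: numeral_2_eq_2)
  then have e: "(m choose 2) + m * m + (k choose 2) + k = (j choose 2) + m * (2 * m - j)"
    by (simp add: k choose_two_add algebra_simps)
  have "q ^ (m choose 2) * q ^ (m * m) * a ^ m * theta_term a b (int j - int m) =
      q ^ (m choose 2) * q ^ (m * m) * q ^ (k choose 2) * (a ^ k * b ^ k) * a ^ j"
    using \<open>k > 0\<close> by (simp add: k theta_term_def q_def[symmetric] power_add mult_ac)
  \<comment> \<open>The negative index contributes \<open>b ^ k\<close>; it pairs with
    \<open>k\<close> of the factors of \<open>a ^ m\<close>.\<close>
  also have "a ^ k * b ^ k = q ^ k"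
    by (simp add: q_def power_mult_distrib)
  also have "q ^ (m choose 2) * q ^ (m * m) * q ^ (k choose 2) * q ^ k * a ^ j =
      q ^ ((m choose 2) + m * m + (k choose 2) + k) * a ^ j"
    by (simp only: power_add)
  finally show ?thesis by (simp add: e power_add power_mult mult_ac)
qed

text \<open>This is the \<open>q\<close>-binomial theorem for \<open>n = 2 m\<close>, \<open>x = a\<close>, \<open>y = q ^ m\<close>: stating the latter
  homogeneously in \<open>x\<close> and \<open>y\<close> avoids negative powers of \<open>q\<close>, and the common factor cancels.\<close>
theorem finite_jacobi_triple_product:
  fixes a b :: "'a::idom"
  assumes "a \<noteq> 0" "b \<noteq> 0"
  defines "q \<equiv> a * b"
  shows "(\<Prod>k<m. (1 + a * q ^ k) * (1 + b * q ^ k)) =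
         (\<Sum>j\<le>2 * m. qbinom q (2 * m) j * theta_term a b (int j - int m))"
proof -
  let ?c = "q ^ (m choose 2) * q ^ (m * m) * a ^ m"
  \<comment> \<open>Since \<open>q = a * b\<close>, the factor for \<open>k\<close> is
    \<open>a * q^k * (1 + b * q^(m-1-k))\<close>, so the lower half of the product yields the
    factors in \<open>b\<close>, in reverse order.\<close>
  have low: "(\<Prod>k<m. q ^ m + a * q ^ k) = q ^ (m choose 2) * a ^ m * (\<Prod>k<m. 1 + b * q ^ k)"
  proof (induction m)
    case (Suc m)
    have "(\<Prod>k<Suc m. q ^ Suc m + a * q ^ k) = (q ^ Suc m + a) * (\<Prod>k<m. q * (q ^ m + a * q ^ k))"
      by (subst prod.lessThan_Suc_shift) (simp add: algebra_simps)
    also have "\<dots> = a * (1 + b * q ^ m) * q ^ m * (q ^ (m choose 2) * a ^ m * (\<Prod>k<m. 1 + b * q ^ k))"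
      by (simp add: prod.distrib Suc.IH) (simp add: q_def algebra_simps)
    finally show ?case by (simp add: numeral_2_eq_2 power_add mult_ac)
  qed (simp add: numeral_2_eq_2)
  have high: "(\<Prod>k<m. q ^ m + a * q ^ (k + m)) = q ^ (m * m) * (\<Prod>k<m. 1 + a * q ^ k)"
  proof -
    have "(\<Prod>k<m. q ^ m + a * q ^ (k + m)) = (\<Prod>k<m. q ^ m * (1 + a * q ^ k))"
      by (simp add: power_add algebra_simps)
    then show ?thesis by (simp add: prod.distrib power_mult)
  qed
  have "(\<Prod>k<2 * m. q ^ m + a * q ^ k) =
      (\<Prod>k<m. q ^ m + a * q ^ k) * (\<Prod>k\<in>{0 + m..<m + m}. q ^ m + a * q ^ k)"
    using prod.atLeastLessThan_concat[of 0 m "2 * m" "\<lambda>k. q ^ m + a * q ^ k"]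
    by (simp add: atLeast0LessThan mult_2)
  also have "(\<Prod>k\<in>{0 + m..<m + m}. q ^ m + a * q ^ k) = (\<Prod>k<m. q ^ m + a * q ^ (k + m))"
    by (simp only: prod.shift_bounds_nat_ivl atLeast0LessThan)
  finally have "?c * (\<Prod>k<m. (1 + a * q ^ k) * (1 + b * q ^ k)) = (\<Prod>k<2 * m. q ^ m + a * q ^ k)"
    by (simp add: low high prod.distrib mult_ac)
  also have "\<dots> = (\<Sum>j\<le>2 * m. qbinom q (2 * m) j * (q ^ (j choose 2) * a ^ j * (q ^ m) ^ (2 * m - j)))"
    by (simp add: qbinomial_theorem mult_ac)
  also have "\<dots> = ?c * (\<Sum>j\<le>2 * m. qbinom q (2 * m) j * theta_term a b (int j - int m))"
    unfolding sum_distrib_left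
  proof (intro sum.cong refl)
    fix j assume "j \<in> {..2 * m}"
    then have T: "q ^ (j choose 2) * a ^ j * (q ^ m) ^ (2 * m - j) = ?c * theta_term a b (int j - int m)"
      using theta_term_shift[of j m a b] by (simp add: q_def)
    show "qbinom q (2 * m) j * (q ^ (j choose 2) * a ^ j * (q ^ m) ^ (2 * m - j)) =
        ?c * (qbinom q (2 * m) j * theta_term a b (int j - int m))"
      unfolding T by (simp only: mult_ac)
  qed
  finally show ?thesis using assms by (simp add: q_def)
qed

section \<open>Coefficientwise limits and the triple product\<close>

text \<open>Convergence of power series means that each coefficient is eventually constant, and a
  coefficient of a product depends on finitely many coefficients of the factors.\<close>

lemma tendsto_fps_mult:
  fixes f g :: "'b \<Rightarrow> 'a::ring_1 fps"
  assumes "(f \<longlongrightarrow> a) F" "(g \<longlongrightarrow> b) F"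
  shows "((\<lambda>x. f x * g x) \<longlongrightarrow> a * b) F"
proof (rule tendsto_fpsI)
  fix n
  have "eventually (\<lambda>x. \<forall>i\<in>{..n}. f x $ i = a $ i) F" "eventually (\<lambda>x. \<forall>i\<in>{..n}. g x $ i = b $ i) F"
    using assms by (auto simp: tendsto_fps_iff eventually_ball_finite_distrib)
  then show "eventually (\<lambda>x. (f x * g x) $ n = (a * b) $ n) F"
    by eventually_elim (auto simp: fps_mult_nth intro!: sum.cong)
qed

lemma tendsto_fps_add:
  fixes f g :: "'b \<Rightarrow> 'a::ring_1 fps"
  assumes "(f \<longlongrightarrow> a) F" "(g \<longlongrightarrow> b) F"
  shows "((\<lambda>x. f x + g x) \<longlongrightarrow> a + b) F"
proof (rule tendsto_fpsI)
  fix n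
  have "eventually (\<lambda>x. f x $ n = a $ n) F" "eventually (\<lambda>x. g x $ n = b $ n) F"
    using assms by (auto simp: tendsto_fps_iff)
  then show "eventually (\<lambda>x. (f x + g x) $ n = (a + b) $ n) F"
    by eventually_elim simp
qed

lemma tendsto_fps_power:
  fixes f :: "'b \<Rightarrow> 'a::ring_1 fps"
  assumes "(f \<longlongrightarrow> a) F"
  shows "((\<lambda>x. f x ^ n) \<longlongrightarrow> a ^ n) F"
  by (induction n) (auto intro: tendsto_fps_mult assms)

lemma tendsto_fps_X_power_dvd:
  fixes f :: "nat \<Rightarrow> 'a::comm_ring_1 fps"
  assumes "\<And>m. fps_X ^ m dvd f m"
  shows "f \<longlonglongrightarrow> 0"
proof (rule tendsto_fpsI)
  fix n
  show "eventually (\<lambda>m. f m $ n = 0 $ n) at_top"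
    using eventually_gt_at_top[of n]
  proof eventually_elim
    case (elim m)
    from assms[of m] obtain g where "f m = fps_X ^ m * g" by (rule dvdE)
    with elim show ?case by (simp add: fps_X_power_mult_nth)
  qed
qed

text \<open>A factor \<open>1 + O(q^k)\<close> does not change coefficients below
  \<open>q^k\<close>, so coefficient \<open>n\<close> is final after \<open>n\<close> factors. This
  turns the coefficientwise definition into a limit.\<close>

lemma fps_prodinf_tendsto:
  assumes "\<And>k. k \<ge> 1 \<Longrightarrow> fps_X ^ k dvd f k - 1"
  shows "(\<lambda>m. \<Prod>k<m. f (Suc k)) \<longlonglongrightarrow> fps_prodinf f"
proof (rule tendsto_fpsI)
  fix n
  have "(\<Prod>k<m. f (Suc k)) $ n = fps_prodinf f $ n" if "n \<le> m" for m
    using that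
  proof (induction m rule: dec_induct)
    case base
    show ?case by (simp add: fps_prodinf_def prod.atLeast1_atMost_eq)
  next
    case (step m)
    from assms[of "Suc m"] obtain g where "f (Suc m) - 1 = fps_X ^ Suc m * g"
      by (auto elim: dvdE)
    then have "(\<Prod>k<Suc m. f (Suc k)) =
        (\<Prod>k<m. f (Suc k)) + fps_X ^ Suc m * (g * (\<Prod>k<m. f (Suc k)))"
      by (simp add: algebra_simps)
    with step show ?case by (simp only: fps_add_nth fps_X_power_mult_nth) simp
  qed
  then show "eventually (\<lambda>m. (\<Prod>k<m. f (Suc k)) $ n = fps_prodinf f $ n) at_top"
    by (auto simp: eventually_at_top_linorder)
qed

lemma qfact_tendsto_qinf:
  assumes "a \<ge> 1"
  shows "qfact (fps_X ^ a) \<longlonglongrightarrow> qinf a"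
proof -
  have "(\<lambda>m. \<Prod>k<m. 1 - fps_X ^ (a * Suc k)) \<longlonglongrightarrow> qinf a"
    unfolding qinf_def using assms
    by (intro fps_prodinf_tendsto) (auto intro!: le_imp_power_dvd)
  moreover have "qfact (fps_X ^ a) = (\<lambda>m. \<Prod>k<m. 1 - fps_X ^ (a * Suc k) :: complex fps)"
    by (simp add: fun_eq_iff qfact_def flip: power_mult power_Suc)
  ultimately show ?thesis by simp
qed

lemma qfact_tendsto_qinf_subseq:
  assumes "a \<ge> 1" "d \<ge> 1"
  shows "(\<lambda>m. qfact (fps_X ^ a) (d * m)) \<longlonglongrightarrow> qinf a"
  using assms by (intro filterlim_compose[OF qfact_tendsto_qinf] mult_nat_left_at_top) auto

lemma qinf_nth_0 [simp]: "qinf a $ 0 = 1"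
  by (simp add: qinf_def fps_prodinf_def)

lemma qfact_nth_0: "q $ 0 = 0 \<Longrightarrow> qfact q n $ 0 = 1"
  by (induction n) (auto simp: qfact_Suc)

text \<open>Passes to the limit in finite product identities with cleared denominators; nonzero
  constant terms make the denominators invertible.\<close>

lemma tendsto_fps_quotient:
  fixes u :: "nat \<Rightarrow> 'a::field fps"
  assumes "\<And>m. u m * d m = n m" "d \<longlonglongrightarrow> D" "n \<longlonglongrightarrow> N" "\<And>m. d m $ 0 \<noteq> 0" "D $ 0 \<noteq> 0"
  shows "u \<longlonglongrightarrow> N * inverse D"
proof -
  have "u = (\<lambda>m. n m * inverse (d m))"
  proof
    fix m
    have "u m = u m * (d m * inverse (d m))"
      using assms(4)[of m] by (simp add: inverse_mult_eq_1')
    then show "u m = n m * inverse (d m)"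
      by (simp only: assms(1)[symmetric] mult.assoc)
  qed
  then show ?thesis
    using assms by (auto intro: tendsto_fps_mult tendsto_inverse_fps)
qed

text \<open>The additional factors \<open>1 - q ^ i\<close> have \<open>i > r\<close>, hence are 1
  modulo \<open>q ^ Suc r\<close>.\<close>

lemma qfact_dvd_diff: "r \<le> n \<Longrightarrow> q ^ Suc r dvd qfact q n - qfact q r"
proof (induction n rule: dec_induct)
  case (step n)
  have "q ^ Suc r dvd q ^ Suc n"
    using step by (intro le_imp_power_dvd) auto
  then have "q ^ Suc r dvd (qfact q n - qfact q r) - q ^ Suc n * qfact q n"
    using step by (intro dvd_diff[of _ "qfact q n - qfact q r"] dvd_mult2)
  then show ?case by (simp add: qfact_Suc algebra_simps)
qed simp

text \<open>Modulo \<open>q ^ Suc r\<close> all \<open>qfact q i\<close> with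
  \<open>i \<ge> r\<close> agree, so the Gaussian binomial is congruent to the inverse of
  \<open>qfact q r\<close>, which \<open>qfact q m\<close> cancels.\<close>

lemma qfact_qbinom_dvd:
  fixes q :: "'a::field fps"
  assumes "q $ 0 = 0" "r \<le> j" "r \<le> 2 * m - j" "j \<le> 2 * m" "r \<le> m"
  shows "q ^ Suc r dvd qfact q m * qbinom q (2 * m) j - 1"
proof -
  define u where "u = qfact q"
  define B where "B = qbinom q (2 * m) j"
  have d: "q ^ Suc r dvd u i - u r" if "r \<le> i" for i
    using that by (simp only: u_def qfact_dvd_diff)
  have e: "B * u j * u (2 * m - j) = u (2 * m)"
    using assms by (simp add: B_def u_def qbinom_qfact)
  \<comment> \<open>The extra factor \<open>u r\<close> lets the identity \<open>e\<close> apply;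
    having constant term 1, it is divided out again.\<close>
  have "u r * (u r * B - 1) =
      (u (2 * m) - u r) - (u j - u r) * (B * u (2 * m - j)) - (u (2 * m - j) - u r) * (B * u r)"
    unfolding e[symmetric] by (simp add: algebra_simps)
  also have "q ^ Suc r dvd \<dots>"
    using assms by (intro dvd_diff[OF dvd_diff] dvd_mult2 d) auto
  finally have "q ^ Suc r dvd inverse (u r) * (u r * (u r * B - 1))"
    by (rule dvd_mult)
  then have "q ^ Suc r dvd u r * B - 1"
    using assms by (simp add: mult.assoc[symmetric] inverse_mult_eq_1 u_def qfact_nth_0)
  then have "q ^ Suc r dvd (u m - u r) * B + (u r * B - 1)"
    using assms by (intro dvd_add dvd_mult2 d)
  then show ?thesis by (simp add: u_def B_def algebra_simps)
qed

definition theta_sum :: "'a::comm_ring_1 \<Rightarrow> 'a \<Rightarrow> nat \<Rightarrow> 'a" where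
  "theta_sum a b m = (\<Sum>n\<in>{- int m..int m}. theta_term a b n)"

text \<open>The finite identity weights each theta term by a factor that is close to 1 in the middle
  of the range, while the outer theta terms have high order. The constant-term condition concerns
  only \<open>a * b\<close>, which admits \<open>b = 1\<close> as in
  \<open>theta_sum_psi\<close>.\<close>

theorem jacobi_triple_product:
  fixes a b :: "'a::field fps"
  assumes "a \<noteq> 0" "b \<noteq> 0" "(a * b) $ 0 = 0"
    and "(\<lambda>m. qfact (a * b) m * (\<Prod>k<m. (1 + a * (a * b) ^ k) * (1 + b * (a * b) ^ k))) \<longlonglongrightarrow> L"
  shows "theta_sum a b \<longlonglongrightarrow> L"
proof -
  define q where "q = a * b"
  have X: "fps_X dvd q"
  proof
    show "q = fps_X * fps_shift 1 q"
      using assms by (auto simp: q_def fps_eq_iff)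
  qed
  let ?P = "\<lambda>m. qfact q m * (\<Prod>k<m. (1 + a * q ^ k) * (1 + b * q ^ k))"
  have "fps_X ^ m dvd theta_sum a b m - ?P m" for m
  proof -
    have "theta_sum a b m = (\<Sum>j\<le>2 * m. theta_term a b (int j - int m))"
      unfolding theta_sum_def
      by (rule sum.reindex_bij_witness[of _ "\<lambda>j. int j - int m" "\<lambda>n. nat (n + int m)"]) auto
    moreover have "?P m = (\<Sum>j\<le>2 * m. qfact q m * qbinom q (2 * m) j * theta_term a b (int j - int m))"
      using assms by (simp add: finite_jacobi_triple_product[of a b, folded q_def] sum_distrib_left mult.assoc)
    ultimately have "theta_sum a b m - ?P m =
        (\<Sum>j\<le>2 * m. - ((qfact q m * qbinom q (2 * m) j - 1) * theta_term a b (int j - int m)))"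
      by (simp only: sum_subtractf[symmetric]) (simp add: algebra_simps)
    also have "fps_X ^ m dvd \<dots>"
    proof (rule dvd_sum)
      fix j assume "j \<in> {..2 * m}"
      define r where "r = min j (2 * m - j)"
      have r: "r \<le> m" "nat \<bar>int j - int m\<bar> = m - r"
        using \<open>j \<in> _\<close> by (auto simp: r_def min_def)
      \<comment> \<open>The weight is accurate up to order \<open>r + 1\<close> and the theta term
        has order at least \<open>m - r choose 2\<close>; this bound makes the total order at least
        \<open>m\<close>.\<close>
      have "d \<le> Suc (d choose 2)" for d
        by (induction d) (auto simp: numeral_2_eq_2)
      from this[of "m - r"] have "m \<le> Suc r + (m - r choose 2)"
        using r by linarith
      then have "fps_X ^ m dvd (fps_X ^ Suc r * fps_X ^ (m - r choose 2) :: 'a fps)"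
        by (simp only: power_add[symmetric] le_imp_power_dvd)
      also have "\<dots> dvd (qfact q m * qbinom q (2 * m) j - 1) * theta_term a b (int j - int m)"
      proof (rule mult_dvd_mono)
        have "q ^ Suc r dvd qfact q m * qbinom q (2 * m) j - 1"
          using \<open>j \<in> _\<close> assms by (intro qfact_qbinom_dvd) (auto simp: q_def r_def min_def)
        then show "fps_X ^ Suc r dvd qfact q m * qbinom q (2 * m) j - 1"
          using dvd_power_same[OF X] dvd_trans by blast
        show "fps_X ^ (m - r choose 2) dvd theta_term a b (int j - int m)"
          unfolding theta_term_def r(2) q_def[symmetric]
          by (intro dvd_mult2 dvd_power_same X)
      qed
      finally show "fps_X ^ m dvd - ((qfact q m * qbinom q (2 * m) j - 1) * theta_term a b (int j - int m))"
        by (simp only: dvd_minus_iff)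
    qed
    finally show ?thesis .
  qed
  then have "(\<lambda>m. theta_sum a b m - ?P m) \<longlonglongrightarrow> 0"
    by (rule tendsto_fps_X_power_dvd)
  from tendsto_fps_add[OF this assms(4)[folded q_def]] show ?thesis by simp
qed

section \<open>Theta series modulo 3\<close>

definition tri :: "int \<Rightarrow> nat" where
  "tri n = nat (n * (n + 1) div 2)"

text \<open>Doubling removes the integer division, so comparing exponents becomes polynomial
  arithmetic in the index, negative indices included.\<close>

lemma tri_eq: "2 * int (tri n) = n * (n + 1)"
proof -
  have "0 \<le> n * (n + 1)" by (cases "n \<ge> 0") (auto simp: mult_nonneg_nonneg mult_nonpos_nonpos)
  moreover have "even (n * (n + 1))" by simp
  ultimately show ?thesis unfolding tri_def by simp
qed

lemma theta_term_altdef: "theta_term a b n = a ^ tri n * b ^ tri (n - 1)"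
proof -
  have c: "2 * int (k choose 2) = int k * (int k - 1)" for k
    by (induction k) (auto simp: numeral_2_eq_2 algebra_simps)
  show ?thesis
  proof (cases "n \<ge> 0")
    case True
    then have "tri n = (nat n choose 2) + nat n" "tri (n - 1) = (nat n choose 2)"
      using c[of "nat n"] tri_eq[of n] tri_eq[of "n - 1"] by (simp_all add: algebra_simps)
    with True show ?thesis
      by (simp add: theta_term_def power_add power_mult_distrib mult_ac)
  next
    case False
    then have "tri (n - 1) = (nat (- n) choose 2) + nat (- n)" "tri n = (nat (- n) choose 2)"
      using c[of "nat (- n)"] tri_eq[of n] tri_eq[of "n - 1"] by (simp_all add: algebra_simps)
    with False show ?thesis
      by (simp add: theta_term_def power_add power_mult_distrib mult_ac)
  qed
qed

lemma theta_term_power: "theta_term (x ^ A) (x ^ B) n = x ^ (A * tri n + B * tri (n - 1))"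
  by (simp add: theta_term_altdef power_add power_mult)

lemma sum_symmetric_Suc:
  fixes f :: "int \<Rightarrow> 'a::comm_monoid_add"
  shows "sum f {- int (Suc m)..int (Suc m)} = sum f {- int m..int m} + (f (int m + 1) + f (- int m - 1))"
proof -
  have "{- int (Suc m)..int (Suc m)} = insert (int m + 1) (insert (- int m - 1) {- int m..int m})"
    by auto
  then show ?thesis by (simp add: add_ac)
qed

text \<open>The bound \<open>3 * m + 1\<close> makes the range a union of complete triples around
  the multiples of 3.\<close>

lemma sum_symmetric_mod_3:
  fixes f :: "int \<Rightarrow> 'a::comm_monoid_add"
  shows "sum f {- int (Suc (3 * m))..int (Suc (3 * m))} =
         (\<Sum>k\<in>{- int m..int m}. f (3 * k) + (f (3 * k + 1) + f (3 * k - 1)))"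
proof (induction m)
  case 0
  have "{- 1..1} = {-1, 0, 1 :: int}" by auto
  then show ?case by (simp add: add_ac)
next
  case (Suc m)
  have e: "3 * Suc m = Suc (Suc (Suc (3 * m)))" by simp
  show ?case
    unfolding e sum_symmetric_Suc[of _ "Suc _"] sum_symmetric_Suc[of _ m] Suc.IH
    by (simp add: algebra_simps) (simp add: minus_diff_commute[of 3 "int m * 3"] minus_diff_commute[of 4 "int m * 3"])
qed

lemma sum_symmetric_minus: "(\<Sum>k\<in>{- int m..int m}. f (- k)) = sum f {- int m..int m}"
  by (rule sum.reindex_bij_witness[of _ uminus uminus]) auto

text \<open>The terms are \<open>y^(n^2)\<close>. The reflection of \<open>n\<close> to
  \<open>- n\<close> exchanges the residue classes 1 and -1 modulo 3, whence the factor 2.\<close>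

lemma theta_sum_split_phi:
  "theta_sum y y (Suc (3 * m)) = theta_sum (y ^ 9) (y ^ 9) m + 2 * y * theta_sum (y ^ 15) (y ^ 3) m"
proof -
  let ?f = "theta_term (y ^ 15) (y ^ 3)"
  have *: "theta_term y y n = y ^ (tri n + tri (n - 1))" for n
    by (simp add: theta_term_altdef power_add)
  have "theta_term y y (3 * k) = theta_term (y ^ 9) (y ^ 9) k"
    "theta_term y y (3 * k + 1) = y * ?f k"
    "theta_term y y (3 * k - 1) = y * ?f (- k)" for k
    unfolding * theta_term_power power_Suc[symmetric]
    using tri_eq[of "3 * k"] tri_eq[of "3 * k - 1"] tri_eq[of "3 * k + 1"] tri_eq[of "3 * k - 2"]
      tri_eq[of k] tri_eq[of "- k"] tri_eq[of "k - 1"] tri_eq[of "- k - 1"]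
    by (auto intro!: arg_cong[where f = "\<lambda>e. y ^ e"] simp: algebra_simps simp del: power_Suc)
  then have "theta_sum y y (Suc (3 * m)) = theta_sum (y ^ 9) (y ^ 9) m +
      (y * theta_sum (y ^ 15) (y ^ 3) m + y * (\<Sum>k\<in>{- int m..int m}. ?f (- k)))"
    unfolding theta_sum_def sum_symmetric_mod_3 by (simp add: sum.distrib sum_distrib_left)
  then show ?thesis
    unfolding sum_symmetric_minus by (simp add: theta_sum_def algebra_simps)
qed

text \<open>The exponent \<open>tri n\<close> is invariant under the reflection of \<open>n\<close>
  to \<open>- 1 - n\<close>, which exchanges the classes 0 and -1 modulo 3 and preserves the class
  1.\<close>

lemma theta_sum_split_psi:
  "theta_sum x 1 (Suc (3 * m)) = 2 * theta_sum (x ^ 6) (x ^ 3) m + x * theta_sum (x ^ 9) 1 m"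
proof -
  let ?f = "theta_term (x ^ 6) (x ^ 3)"
  have *: "theta_term (x ^ A) 1 n = x ^ (A * tri n)" for A n
    by (simp add: theta_term_altdef power_mult)
  have "theta_term x 1 (3 * k) = ?f k"
    "theta_term x 1 (3 * k + 1) = x * theta_term (x ^ 9) 1 k"
    "theta_term x 1 (3 * k - 1) = ?f (- k)" for k
    unfolding * *[of 1, simplified] theta_term_power power_Suc[symmetric]
    using tri_eq[of "3 * k"] tri_eq[of "3 * k - 1"] tri_eq[of "3 * k + 1"]
      tri_eq[of k] tri_eq[of "- k"] tri_eq[of "k - 1"] tri_eq[of "- k - 1"]
    by (auto intro!: arg_cong[where f = "\<lambda>e. x ^ e"] simp: algebra_simps simp del: power_Suc)
  then have "theta_sum x 1 (Suc (3 * m)) = theta_sum (x ^ 6) (x ^ 3) m +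
      (x * theta_sum (x ^ 9) 1 m + (\<Sum>k\<in>{- int m..int m}. ?f (- k)))"
    unfolding theta_sum_def sum_symmetric_mod_3 by (simp add: sum.distrib sum_distrib_left)
  then show ?thesis
    unfolding sum_symmetric_minus by (simp add: theta_sum_def algebra_simps)
qed

section \<open>Theta series as infinite products\<close>

lemma prod_one_plus_qfact: "(\<Prod>k<m. 1 + x ^ Suc k) * qfact x m = qfact (x ^ 2) m"
proof -
  have "(1 + x ^ Suc k) * (1 - x ^ Suc k) = 1 - (x ^ 2) ^ Suc k" for k
  proof -
    have "(x ^ 2) ^ Suc k = (x ^ Suc k) ^ 2"
      by (simp only: power_mult[symmetric] mult.commute)
    then show ?thesis
      by (simp only: power2_eq_square) (simp only: algebra_simps, simp)
  qed
  then show ?thesis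
    by (simp only: qfact_def prod.distrib[symmetric])
qed

text \<open>Separates the odd from the even exponents in \<open>(x; x)_(2m)\<close>.\<close>

lemma qfact_phi: "(\<Prod>k<m. 1 - x * (x ^ 2) ^ k) * qfact (x ^ 2) m = qfact x (2 * m)"
proof (induction m)
  case (Suc m)
  have e: "2 * Suc m = Suc (Suc (2 * m))" by simp
  have p: "x ^ Suc (2 * m) = x * (x ^ 2) ^ m" "x ^ Suc (Suc (2 * m)) = (x ^ 2) ^ Suc m"
    by (simp_all add: power_mult) (simp add: power2_eq_square mult_ac)
  show ?case
    unfolding e qfact_Suc p prod.lessThan_Suc Suc.IH[symmetric] by (simp only: mult_ac)
qed simp

text \<open>The product of \<open>1 + x ^ k\<close> begins with 2 at \<open>k = 0\<close> and stops
  before \<open>k = m\<close>; the extra factor \<open>1 + x ^ m\<close> completes it and tends to 1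
  when \<open>x\<close> has zero constant term.\<close>

lemma qfact_psi:
  "qfact x m * (\<Prod>k<m. (1 + x * x ^ k) * (1 + x ^ k)) * (qfact x m * (1 + x ^ m)) = 2 * qfact (x ^ 2) m ^ 2"
proof -
  have "(\<Prod>k<m. 1 + x ^ k) * (1 + x ^ m) = (\<Prod>k<Suc m. 1 + x ^ k)"
    by simp
  also have "\<dots> = 2 * (\<Prod>k<m. 1 + x ^ Suc k)"
    by (subst prod.lessThan_Suc_shift) simp
  finally have s: "(\<Prod>k<m. 1 + x ^ k) * (1 + x ^ m) = 2 * (\<Prod>k<m. 1 + x ^ Suc k)" .
  have "qfact x m * (\<Prod>k<m. (1 + x * x ^ k) * (1 + x ^ k)) * (qfact x m * (1 + x ^ m)) =
      ((\<Prod>k<m. 1 + x ^ Suc k) * qfact x m) * qfact x m * ((\<Prod>k<m. 1 + x ^ k) * (1 + x ^ m))"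
    by (simp add: prod.distrib mult_ac)
  also have "\<dots> = 2 * ((\<Prod>k<m. 1 + x ^ Suc k) * qfact x m) ^ 2"
    unfolding s by (simp add: power2_eq_square mult_ac)
  finally show ?thesis by (simp only: prod_one_plus_qfact)
qed

text \<open>The exponents 1 and 5 modulo 6 are those coprime to 6: remove the multiples of 2 and of
  3, then restore the multiples of 6, which were removed twice.\<close>

lemma qfact_theta_1_5:
  "(\<Prod>k<m. (1 - x ^ 5 * (x ^ 6) ^ k) * (1 - x * (x ^ 6) ^ k)) * (qfact (x ^ 3) (2 * m) * qfact (x ^ 2) (3 * m)) =
    qfact x (6 * m) * qfact (x ^ 6) m"
proof (induction m)
  case (Suc m)
  \<comment> \<open>In terms of \<open>y\<close>, both sides gain the same seven factors
    \<open>1 - x^i * y\<close>, with \<open>i = 6\<close> occurring twice.\<close>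
  define y where "y = x ^ (6 * m)"
  have e: "2 * Suc m = Suc (Suc (2 * m))" "3 * Suc m = Suc (Suc (Suc (3 * m)))"
     "6 * Suc m = Suc (Suc (Suc (Suc (Suc (Suc (6 * m))))))" by simp_all
  have p: "(x ^ 6) ^ k = x ^ (6 * k)" "(x ^ 3) ^ k = x ^ (3 * k)" "(x ^ 2) ^ k = x ^ (2 * k)" for k
    by (simp_all add: power_mult)
  have q: "6 * Suc m = 6 + 6 * m" "3 * Suc (2 * m) = 3 + 6 * m" "3 * Suc (Suc (2 * m)) = 6 + 6 * m"
     "2 * Suc (3 * m) = 2 + 6 * m" "2 * Suc (Suc (3 * m)) = 4 + 6 * m"
     "2 * Suc (Suc (Suc (3 * m))) = 6 + 6 * m"
    by simp_all
  have y: "x ^ Suc (6 * m) = x * y" by (simp add: y_def)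
  have y2: "x ^ Suc (Suc (6 * m)) = x ^ 2 * y"
    unfolding y_def power_add[symmetric] by (rule arg_cong[where f = "power x"], simp)
  have y3: "x ^ Suc (Suc (Suc (6 * m))) = x ^ 3 * y"
    unfolding y_def power_add[symmetric] by (rule arg_cong[where f = "power x"], simp)
  have y4: "x ^ Suc (Suc (Suc (Suc (6 * m)))) = x ^ 4 * y"
    unfolding y_def power_add[symmetric] by (rule arg_cong[where f = "power x"], simp)
  have y5: "x ^ Suc (Suc (Suc (Suc (Suc (6 * m))))) = x ^ 5 * y"
    unfolding y_def power_add[symmetric] by (rule arg_cong[where f = "power x"], simp)
  have y6: "x ^ Suc (Suc (Suc (Suc (Suc (Suc (6 * m)))))) = x ^ 6 * y"
    unfolding y_def power_add[symmetric] by (rule arg_cong[where f = "power x"], simp)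
  have l: "(\<Prod>k<Suc m. (1 - x ^ 5 * (x ^ 6) ^ k) * (1 - x * (x ^ 6) ^ k)) *
      (qfact (x ^ 3) (2 * Suc m) * qfact (x ^ 2) (3 * Suc m)) =
     ((\<Prod>k<m. (1 - x ^ 5 * (x ^ 6) ^ k) * (1 - x * (x ^ 6) ^ k)) * (qfact (x ^ 3) (2 * m) * qfact (x ^ 2) (3 * m))) *
     ((1 - x ^ 5 * y) * (1 - x * y) * (1 - x ^ 3 * y) * (1 - x ^ 6 * y) * (1 - x ^ 2 * y) * (1 - x ^ 4 * y) * (1 - x ^ 6 * y))"
    unfolding e(1,2) qfact_Suc prod.lessThan_Suc unfolding p q power_add y_def[symmetric]
    by (simp only: mult_ac)
  have r: "qfact x (6 * Suc m) * qfact (x ^ 6) (Suc m) = (qfact x (6 * m) * qfact (x ^ 6) m) *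
     ((1 - x ^ 5 * y) * (1 - x * y) * (1 - x ^ 3 * y) * (1 - x ^ 6 * y) * (1 - x ^ 2 * y) * (1 - x ^ 4 * y) * (1 - x ^ 6 * y))"
    unfolding qfact_Suc[of "x ^ 6"] unfolding e(3) p q power_add unfolding qfact_Suc y y2 y3 y4 y5 y6 y_def[symmetric]
    by (simp only: mult_ac)
  show ?case unfolding l r Suc.IH ..
qed simp

text \<open>As \<open>(1 + z) * (1 - z) = 1 - z^2\<close>, the product of \<open>1 + x^n\<close> up
  to \<open>n = 3m\<close> is a quotient of Pochhammer symbols in \<open>x^2\<close> and
  \<open>x\<close>; the same quotient in \<open>x^6\<close> and \<open>x^3\<close> accounts for the
  multiples of 3, which have to be left out.\<close>

lemma qfact_theta_1_2:
  "(\<Prod>k<m. (1 + x ^ 2 * (x ^ 3) ^ k) * (1 + x * (x ^ 3) ^ k)) * (qfact x (3 * m) * qfact (x ^ 6) m) =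
    qfact (x ^ 2) (3 * m) * qfact (x ^ 3) m"
proof (induction m)
  case (Suc m)
  define y where "y = x ^ (3 * m)"
  have e: "3 * Suc m = Suc (Suc (Suc (3 * m)))" by simp
  have p: "(x ^ 6) ^ k = (x ^ (3 * k)) ^ 2" "(x ^ 3) ^ k = x ^ (3 * k)" "(x ^ 2) ^ k = (x ^ k) ^ 2" for k
    by (simp_all flip: power_mult) (simp only: mult.commute)
  have q: "x ^ Suc (3 * m) = x * y" "x ^ Suc (Suc (3 * m)) = x ^ 2 * y"
     "x ^ Suc (Suc (Suc (3 * m))) = x ^ 3 * y"
    by (simp_all add: y_def power2_eq_square power3_eq_cube mult_ac)
  have s: "1 - z ^ 2 = (1 + z) * (1 - z)" for z :: 'a
    by (simp add: power2_eq_square algebra_simps)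
  have l: "(\<Prod>k<Suc m. (1 + x ^ 2 * (x ^ 3) ^ k) * (1 + x * (x ^ 3) ^ k)) *
      (qfact x (3 * Suc m) * qfact (x ^ 6) (Suc m)) =
     ((\<Prod>k<m. (1 + x ^ 2 * (x ^ 3) ^ k) * (1 + x * (x ^ 3) ^ k)) * (qfact x (3 * m) * qfact (x ^ 6) m)) *
     ((1 + x ^ 2 * y) * (1 + x * y) * (1 - x * y) * (1 - x ^ 2 * y) * (1 - x ^ 3 * y) * (1 - (x ^ 3 * y) ^ 2))"
    unfolding prod.lessThan_Suc qfact_Suc[of "x ^ 6"] unfolding e p qfact_Suc q y_def[symmetric]
    by (simp only: mult_ac)
  have r: "qfact (x ^ 2) (3 * Suc m) * qfact (x ^ 3) (Suc m) = (qfact (x ^ 2) (3 * m) * qfact (x ^ 3) m) *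
     ((1 + x ^ 2 * y) * (1 + x * y) * (1 - x * y) * (1 - x ^ 2 * y) * (1 - x ^ 3 * y) * (1 - (x ^ 3 * y) ^ 2))"
    unfolding qfact_Suc[of "x ^ 3"] unfolding e p qfact_Suc q s y_def[symmetric]
    by (simp only: mult_ac)
  show ?case unfolding l r Suc.IH ..
qed simp

lemma theta_sum_phi:
  assumes "c \<ge> 1"
  shows "theta_sum (- (fps_X ^ c)) (- (fps_X ^ c)) \<longlonglongrightarrow> qinf c ^ 2 * inverse (qinf (2 * c))"
proof (rule jacobi_triple_product)
  let ?x = "fps_X ^ c :: complex fps"
  have q: "- ?x * - ?x = fps_X ^ (2 * c)" by (simp add: mult_2 power_add)
  have x2: "?x ^ 2 = fps_X ^ (2 * c)" by (simp add: mult.commute flip: power_mult)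
  show "(\<lambda>m. qfact (- ?x * - ?x) m *
       (\<Prod>k<m. (1 + - ?x * (- ?x * - ?x) ^ k) * (1 + - ?x * (- ?x * - ?x) ^ k)))
      \<longlonglongrightarrow> qinf c ^ 2 * inverse (qinf (2 * c))"
    unfolding q
  proof (rule tendsto_fps_quotient)
    fix m
    have "qfact (fps_X ^ (2 * c)) m *
          (\<Prod>k<m. (1 + - ?x * (fps_X ^ (2 * c)) ^ k) * (1 + - ?x * (fps_X ^ (2 * c)) ^ k)) *
          qfact (fps_X ^ (2 * c)) m =
         ((\<Prod>k<m. 1 - ?x * (?x ^ 2) ^ k) * qfact (?x ^ 2) m) ^ 2"
      by (simp add: x2 prod.distrib) (simp add: power2_eq_square mult_ac)
    then show "qfact (fps_X ^ (2 * c)) m *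
          (\<Prod>k<m. (1 + - ?x * (fps_X ^ (2 * c)) ^ k) * (1 + - ?x * (fps_X ^ (2 * c)) ^ k)) *
          qfact (fps_X ^ (2 * c)) m = qfact ?x (2 * m) ^ 2"
      by (simp only: qfact_phi)
  qed (use assms in \<open>auto simp: qfact_nth_0 intro!: tendsto_fps_power qfact_tendsto_qinf qfact_tendsto_qinf_subseq\<close>)
qed (use assms in auto)

text \<open>The summation over all integers counts every triangular number twice, whence the factor 2.\<close>
lemma theta_sum_psi:
  assumes "c \<ge> 1"
  shows "theta_sum (fps_X ^ c) 1 \<longlonglongrightarrow> 2 * qinf (2 * c) ^ 2 * inverse (qinf c)"
proof (rule jacobi_triple_product)
  let ?x = "fps_X ^ c :: complex fps"
  have x2: "?x ^ 2 = fps_X ^ (2 * c)" by (simp add: mult.commute flip: power_mult)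
  have 0: "(\<lambda>m. ?x ^ m) \<longlonglongrightarrow> 0"
    by (rule tendsto_fps_X_power_dvd) (use assms in \<open>auto simp: dvd_power_same\<close>)
  have d: "(\<lambda>m. qfact ?x m * (1 + ?x ^ m)) \<longlonglongrightarrow> qinf c * (1 + 0)"
    using assms by (intro tendsto_fps_mult tendsto_fps_add 0 qfact_tendsto_qinf tendsto_const)
  show "(\<lambda>m. qfact (?x * 1) m * (\<Prod>k<m. (1 + ?x * (?x * 1) ^ k) * (1 + 1 * (?x * 1) ^ k)))
      \<longlonglongrightarrow> 2 * qinf (2 * c) ^ 2 * inverse (qinf c)"
    unfolding mult_1_right mult_1_left
  proof (rule tendsto_fps_quotient[OF qfact_psi])
    show "(\<lambda>m. qfact ?x m * (1 + ?x ^ m)) \<longlonglongrightarrow> qinf c" using d by simp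
    \<comment> \<open>The constant term is 2 for \<open>m = 0\<close> and 1 otherwise.\<close>
    show "(qfact ?x m * (1 + ?x ^ m)) $ 0 \<noteq> 0" for m
      using assms by (cases "m = 0") (auto simp: qfact_nth_0 fps_power_zeroth power_0_left)
  qed (use assms in \<open>auto simp: x2 intro!: tendsto_fps_mult tendsto_fps_power qfact_tendsto_qinf\<close>)
qed (use assms in auto)

lemma theta_sum_1_5:
  assumes "c \<ge> 1"
  shows "theta_sum (- (fps_X ^ (5 * c))) (- (fps_X ^ c)) \<longlonglongrightarrow>
    qinf (6 * c) * (qinf c * qinf (6 * c)) * inverse (qinf (3 * c) * qinf (2 * c))"
proof (rule jacobi_triple_product)
  let ?x = "fps_X ^ c :: complex fps"
  have x: "?x ^ n = fps_X ^ (n * c)" for n by (simp add: mult.commute flip: power_mult)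
  let ?z = "fps_X ^ (5 * c) :: complex fps"
  have q: "- ?z * - ?x = ?x ^ 6" by (simp add: x flip: power_add)
  show "(\<lambda>m. qfact (- ?z * - ?x) m *
       (\<Prod>k<m. (1 + - ?z * (- ?z * - ?x) ^ k) * (1 + - ?x * (- ?z * - ?x) ^ k)))
      \<longlonglongrightarrow> qinf (6 * c) * (qinf c * qinf (6 * c)) * inverse (qinf (3 * c) * qinf (2 * c))"
    unfolding q
  proof (rule tendsto_fps_quotient)
    fix m
    show "qfact (?x ^ 6) m *
          (\<Prod>k<m. (1 + - ?z * (?x ^ 6) ^ k) * (1 + - ?x * (?x ^ 6) ^ k)) *
          (qfact (?x ^ 3) (2 * m) * qfact (?x ^ 2) (3 * m)) =
         qfact (?x ^ 6) m * (qfact ?x (6 * m) * qfact (?x ^ 6) m)"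
      unfolding qfact_theta_1_5[symmetric] unfolding x[of 5] by (simp add: mult_ac)
  qed (use assms in \<open>auto simp: x qfact_nth_0 intro!: tendsto_fps_mult qfact_tendsto_qinf qfact_tendsto_qinf_subseq\<close>)
qed (use assms in auto)

lemma theta_sum_1_2:
  assumes "c \<ge> 1"
  shows "theta_sum (fps_X ^ (2 * c)) (fps_X ^ c) \<longlonglongrightarrow>
    qinf (3 * c) * (qinf (2 * c) * qinf (3 * c)) * inverse (qinf c * qinf (6 * c))"
proof (rule jacobi_triple_product)
  let ?x = "fps_X ^ c :: complex fps"
  have x: "?x ^ n = fps_X ^ (n * c)" for n by (simp add: mult.commute flip: power_mult)
  have q: "fps_X ^ (2 * c) * ?x = ?x ^ 3" by (simp add: x flip: power_add)
  show "(\<lambda>m. qfact (fps_X ^ (2 * c) * ?x) m *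
       (\<Prod>k<m. (1 + fps_X ^ (2 * c) * (fps_X ^ (2 * c) * ?x) ^ k) * (1 + ?x * (fps_X ^ (2 * c) * ?x) ^ k)))
      \<longlonglongrightarrow> qinf (3 * c) * (qinf (2 * c) * qinf (3 * c)) * inverse (qinf c * qinf (6 * c))"
    unfolding q
  proof (rule tendsto_fps_quotient)
    fix m
    show "qfact (?x ^ 3) m *
          (\<Prod>k<m. (1 + fps_X ^ (2 * c) * (?x ^ 3) ^ k) * (1 + ?x * (?x ^ 3) ^ k)) *
          (qfact ?x (3 * m) * qfact (?x ^ 6) m) =
         qfact (?x ^ 3) m * (qfact (?x ^ 2) (3 * m) * qfact (?x ^ 3) m)"
      unfolding qfact_theta_1_2[symmetric] unfolding x[of 2] by (simp add: mult_ac)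
  qed (use assms in \<open>auto simp: x qfact_nth_0 intro!: tendsto_fps_mult qfact_tendsto_qinf qfact_tendsto_qinf_subseq\<close>)
qed (use assms in auto)

text \<open>Both sides are limits of the partial sums of \<open>\<phi>(-q)\<close> along the indices
  \<open>3 * m + 1\<close>, the right one after splitting modulo 3.\<close>

lemma qinf_split_phi:
  "qinf 1 ^ 2 * inverse (qinf 2) = qinf 9 ^ 2 * inverse (qinf 18) -
     2 * fps_X * (qinf 18 * (qinf 3 * qinf 18) * inverse (qinf 9 * qinf 6))"
proof -
  let ?y = "- fps_X :: complex fps"
  have "(\<lambda>m. theta_sum ?y ?y (Suc (3 * m))) \<longlonglongrightarrow> qinf 1 ^ 2 * inverse (qinf 2)"
    using LIMSEQ_subseq_LIMSEQ[OF theta_sum_phi[of 1], of "\<lambda>m. Suc (3 * m)"]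
    by (simp add: o_def strict_mono_def)
  moreover have "(\<lambda>m. theta_sum ?y ?y (Suc (3 * m))) \<longlonglongrightarrow> qinf 9 ^ 2 * inverse (qinf 18) +
     2 * ?y * (qinf 18 * (qinf 3 * qinf 18) * inverse (qinf 9 * qinf 6))"
    unfolding theta_sum_split_phi
    using theta_sum_phi[of 9] theta_sum_1_5[of 3]
    by (intro tendsto_fps_add tendsto_fps_mult tendsto_const) simp_all
  ultimately have "qinf 1 ^ 2 * inverse (qinf 2) = qinf 9 ^ 2 * inverse (qinf 18) +
     2 * ?y * (qinf 18 * (qinf 3 * qinf 18) * inverse (qinf 9 * qinf 6))"
    by (rule LIMSEQ_unique)
  then show ?thesis by simp
qed

lemma qinf_split_psi:
  "2 * qinf 2 ^ 2 * inverse (qinf 1) = 2 * (qinf 9 * (qinf 6 * qinf 9) * inverse (qinf 3 * qinf 18)) +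
     fps_X * (2 * qinf 18 ^ 2 * inverse (qinf 9))"
proof -
  let ?x = "fps_X :: complex fps"
  have "(\<lambda>m. theta_sum ?x 1 (Suc (3 * m))) \<longlonglongrightarrow> 2 * qinf 2 ^ 2 * inverse (qinf 1)"
    using LIMSEQ_subseq_LIMSEQ[OF theta_sum_psi[of 1], of "\<lambda>m. Suc (3 * m)"]
    by (simp add: o_def strict_mono_def)
  moreover have "(\<lambda>m. theta_sum ?x 1 (Suc (3 * m))) \<longlonglongrightarrow>
     2 * (qinf 9 * (qinf 6 * qinf 9) * inverse (qinf 3 * qinf 18)) +
     fps_X * (2 * qinf 18 ^ 2 * inverse (qinf 9))"
    unfolding theta_sum_split_psi
    using theta_sum_psi[of 9] theta_sum_1_2[of 3]
    by (intro tendsto_fps_add tendsto_fps_mult tendsto_const) simp_all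
  ultimately show ?thesis
    by (rule LIMSEQ_unique)
qed

section \<open>The dissection and the cube root of unity\<close>

text \<open>In the product of the two split theta series, the cross terms are
  \<open>q * E 9 * E 18\<close> and \<open>-2 * q * E 9 * E 18\<close>; they merge into the single
  middle component.\<close>

lemma qinf_dissection:
  "qinf 1 * qinf 2 * inverse (qinf 3) =
    qinf 9 ^ 4 * qinf 6 * inverse (qinf 3 ^ 2 * qinf 18 ^ 2)
    + fps_X * - (qinf 18 * qinf 9 * inverse (qinf 3))
    + fps_X ^ 2 * - (2 * qinf 18 ^ 4 * inverse (qinf 9 ^ 2 * qinf 6))"
proof -
  define E where "E = qinf"
  define I where "I k = inverse (qinf k)" for k
  have EI: "E k * I k = 1" for k
    by (simp add: E_def I_def inverse_mult_eq_1')
  have c: "E k * (I k * z) = z" for k z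
    by (simp add: EI flip: mult.assoc)
  note phi = qinf_split_phi[unfolded fps_inverse_mult, folded I_def, folded E_def]
  note psi = qinf_split_psi[unfolded fps_inverse_mult, folded I_def, folded E_def]
  \<comment> \<open>\<open>psi\<close> expands twice the series \<open>\<psi>(q)\<close>, so the
    identity is shown in doubled form and the 2 cancelled at the end.\<close>
  have "2 * (E 1 * E 2) * I 3 = (E 1 ^ 2 * I 2) * (2 * E 2 ^ 2 * I 1) * I 3"
    by (simp add: power2_eq_square mult_ac c)
  also have "\<dots> = 2 * (E 9 ^ 4 * E 6 * (I 3 ^ 2 * I 18 ^ 2) + fps_X * - (E 18 * E 9 * I 3)
      + fps_X ^ 2 * - (2 * E 18 ^ 4 * (I 9 ^ 2 * I 6)))"
    unfolding phi psi
    by (simp add: algebra_simps power2_eq_square power4_eq_xxxx c EI)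
  finally have "2 * (E 1 * E 2 * I 3) = 2 * (E 9 ^ 4 * E 6 * (I 3 ^ 2 * I 18 ^ 2) + fps_X * - (E 18 * E 9 * I 3)
      + fps_X ^ 2 * - (2 * E 18 ^ 4 * (I 9 ^ 2 * I 6)))"
    by (simp only: mult.assoc)
  then show ?thesis
    unfolding mult_cancel_left by (simp add: E_def I_def fps_inverse_mult fps_inverse_power)
qed

text \<open>Coefficient \<open>n\<close> of \<open>f oo g\<close> involves only the coefficients of
  \<open>f\<close> up to index \<open>n\<close>.\<close>

lemma tendsto_fps_compose:
  fixes f :: "'b \<Rightarrow> 'a::comm_ring_1 fps"
  assumes "(f \<longlongrightarrow> a) F"
  shows "((\<lambda>x. f x oo g) \<longlongrightarrow> a oo g) F"
proof (rule tendsto_fpsI)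
  fix n
  have "eventually (\<lambda>x. \<forall>i\<in>{0..n}. f x $ i = a $ i) F"
    using assms by (auto simp: tendsto_fps_iff eventually_ball_finite_distrib)
  then show "eventually (\<lambda>x. (f x oo g) $ n = (a oo g) $ n) F"
    by eventually_elim (auto simp: fps_compose_nth intro!: sum.cong)
qed

lemma qinf_compose:
  assumes "a \<ge> 1" "c \<ge> 1"
  shows "qinf a oo fps_X ^ c = qinf (a * c)"
proof -
  have c: "(fps_X ^ c :: complex fps) $ 0 = 0" using assms by simp
  have "qfact (fps_X ^ a :: complex fps) m oo fps_X ^ c = qfact (fps_X ^ (a * c)) m" for m
    by (simp only: qfact_def fps_compose_prod_distrib[OF c] fps_compose_sub_distrib fps_compose_1
          power_mult[symmetric] fps_X_power_compose[OF c])
       (simp add: algebra_simps)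
  then have "(\<lambda>m. qfact (fps_X ^ (a * c)) m) \<longlonglongrightarrow> (qinf a oo fps_X ^ c)"
    using tendsto_fps_compose[OF qfact_tendsto_qinf[OF assms(1)], of "fps_X ^ c"] by simp
  moreover have "(\<lambda>m. qfact (fps_X ^ (a * c)) m) \<longlonglongrightarrow> qinf (a * c)"
    using assms by (intro qfact_tendsto_qinf) simp
  ultimately show ?thesis by (rule LIMSEQ_unique)
qed

section \<open>The crank generating function at a cube root of unity\<close>

abbreviation crank_denom :: "complex \<Rightarrow> nat \<Rightarrow> complex fps" where
  "crank_denom z k \<equiv> (1 - fps_const z * fps_X ^ k) * (1 - fps_const (inverse z) * fps_X ^ k)"

abbreviation crank_factor :: "complex \<Rightarrow> nat \<Rightarrow> complex fps" where
  "crank_factor z k \<equiv> (1 + fps_X ^ k) * (1 - fps_X ^ k) * inverse (crank_denom z k)"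

lemma crank_denom_nth_0: "k \<ge> 1 \<Longrightarrow> crank_denom z k $ 0 = 1"
  by simp

text \<open>Numerator and denominator of the \<open>k\<close>-th factor agree modulo
  \<open>q^k\<close>.\<close>

lemma crank_gf_tendsto: "(\<lambda>m. \<Prod>k<m. crank_factor z (Suc k)) \<longlonglongrightarrow> crank_gf z"
  unfolding crank_gf_def
proof (rule fps_prodinf_tendsto)
  fix k :: nat assume k: "k \<ge> 1"
  let ?D = "crank_denom z k"
  have inv: "?D * inverse ?D = 1"
    by (rule inverse_mult_eq_1') (simp only: crank_denom_nth_0[OF k], simp)
  have "crank_factor z k - 1 = ((1 + fps_X ^ k) * (1 - fps_X ^ k) - ?D) * inverse ?D"
    by (simp only: left_diff_distrib[of _ ?D "inverse ?D"] inv)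
  also have "(1 + fps_X ^ k) * (1 - fps_X ^ k) - ?D =
      fps_X ^ k * (fps_const z + fps_const (inverse z) - fps_const z * fps_const (inverse z) * fps_X ^ k - fps_X ^ k)"
    by (simp add: algebra_simps del: fps_const_add fps_const_mult)
  finally show "fps_X ^ k dvd crank_factor z k - 1"
    by simp
qed

lemma crank_gf_cube_root:
  assumes "\<zeta> ^ 3 = 1" "\<zeta> \<noteq> 1"
  shows "crank_gf \<zeta> = qinf 1 * qinf 2 * inverse (qinf 3)"
proof (rule LIMSEQ_unique[OF crank_gf_tendsto], rule tendsto_fps_quotient)
  fix m
  have "(\<zeta> - 1) * (\<zeta> ^ 2 + \<zeta> + 1) = 0"
    using assms(1) by (simp add: algebra_simps power2_eq_square power3_eq_cube)
  then have s: "\<zeta> ^ 2 + \<zeta> + 1 = 0" using assms(2) by simp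
  have i: "inverse \<zeta> = \<zeta> ^ 2"
    using assms by (intro inverse_unique) (simp add: power2_eq_square power3_eq_cube mult.assoc)
  have den: "crank_denom \<zeta> k * (1 - fps_X ^ k) = 1 - (fps_X ^ 3) ^ k" for k
  proof -
    define x :: "complex fps" where "x = fps_X ^ k"
    define c where "c = fps_const \<zeta>"
    have "c ^ 2 + c + 1 = fps_const (\<zeta> ^ 2 + \<zeta> + 1)"
      by (simp add: c_def flip: fps_const_add fps_const_power)
    then have c: "fps_const (inverse \<zeta>) = c ^ 2" "c ^ 2 + c + 1 = 0"
      unfolding i s by (simp_all add: c_def)
    have c3: "c * c ^ 2 = 1" using assms(1) by (simp add: c_def flip: power_Suc)
    \<comment> \<open>Because \<open>c^3 = 1\<close>, the coefficients of \<open>x\<close> and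
      \<open>x^2\<close> are both \<open>c^2 + c + 1\<close> up to sign and vanish.\<close>
    have "(1 - c * x) * (1 - c ^ 2 * x) * (1 - x) =
        1 - (c ^ 2 + c + 1) * x + (c + c ^ 2 + c * c ^ 2) * x ^ 2 - c * c ^ 2 * x ^ 3"
      by (simp add: algebra_simps power2_eq_square power3_eq_cube)
    also have "\<dots> = 1 - x ^ 3" using c(2) by (simp add: c3 add.commute)
    finally show ?thesis
      unfolding c(1) x_def c_def by (simp add: power_mult[symmetric] mult.commute)
  qed
  have "crank_factor \<zeta> (Suc k) * (1 - (fps_X ^ 3) ^ Suc k) =
      (1 - fps_X ^ Suc k) * (1 - (fps_X ^ 2) ^ Suc k)" for k
  proof -
    let ?x = "fps_X ^ Suc k :: complex fps"
    have "crank_factor \<zeta> (Suc k) * (crank_denom \<zeta> (Suc k) * (1 - ?x)) =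
       (1 + ?x) * (1 - ?x) * (1 - ?x) * (inverse (crank_denom \<zeta> (Suc k)) * crank_denom \<zeta> (Suc k))"
      by (simp only: mult_ac)
    also have "inverse (crank_denom \<zeta> (Suc k)) * crank_denom \<zeta> (Suc k) = 1"
      by (rule inverse_mult_eq_1) (simp only: crank_denom_nth_0, simp)
    finally have "crank_factor \<zeta> (Suc k) * (1 - (fps_X ^ 3) ^ Suc k) =
        (1 + ?x) * (1 - ?x) * (1 - ?x)"
      by (simp only: den mult_1_right)
    also have "\<dots> = (1 - ?x) * (1 - ?x ^ 2)"
      by (simp add: power2_eq_square algebra_simps)
    also have "?x ^ 2 = (fps_X ^ 2) ^ Suc k"
      by (simp only: power_mult[symmetric] mult.commute)
    finally show ?thesis .
  qed
  then show "(\<Prod>k<m. crank_factor \<zeta> (Suc k)) * qfact (fps_X ^ 3) m =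
      qfact (fps_X ^ 1) m * qfact (fps_X ^ 2) m"
    by (simp only: qfact_def prod.distrib[symmetric] power_one_right)
qed (use qfact_tendsto_qinf[of 1] in \<open>auto simp: qfact_nth_0 intro!: tendsto_fps_mult qfact_tendsto_qinf\<close>)

section \<open>Laurent expansion of the crank generating function\<close>

text \<open>The point 0 is excluded since the junk value \<open>inverse 0 = 0\<close> would rule out \<open>inverse\<close>.\<close>
definition laurent_poly :: "(complex \<Rightarrow> complex) \<Rightarrow> bool" where
  "laurent_poly f \<longleftrightarrow>
     (\<exists>N p. (\<forall>i. coeff p i \<in> \<int>) \<and> (\<forall>z. z \<noteq> 0 \<longrightarrow> f z * z ^ N = poly p z))"

lemma laurent_polyI:
  assumes "\<And>i. coeff p i \<in> \<int>" "\<And>z. z \<noteq> 0 \<Longrightarrow> f z * z ^ N = poly p z"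
  shows "laurent_poly f"
  unfolding laurent_poly_def using assms by blast

lemma laurent_poly_const: "c \<in> \<int> \<Longrightarrow> laurent_poly (\<lambda>z. c)"
  by (rule laurent_polyI[of "[:c:]" _ 0]) (auto simp: coeff_pCons split: nat.split)

lemma laurent_poly_id: "laurent_poly (\<lambda>z. z)"
  by (rule laurent_polyI[of "[:0, 1:]" _ 0]) (auto simp: coeff_pCons split: nat.split)

lemma laurent_poly_inverse: "laurent_poly (\<lambda>z. inverse z)"
  by (rule laurent_polyI[of "[:1:]" _ 1]) (auto simp: coeff_pCons split: nat.split)

lemma laurent_poly_mult:
  assumes "laurent_poly f" "laurent_poly g"
  shows "laurent_poly (\<lambda>z. f z * g z)"
proof -
  from assms obtain N p N' p' where p: "\<And>i. coeff p i \<in> \<int>" "\<And>i. coeff p' i \<in> \<int>"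
    and fg: "\<And>z. z \<noteq> 0 \<Longrightarrow> f z * z ^ N = poly p z" "\<And>z. z \<noteq> 0 \<Longrightarrow> g z * z ^ N' = poly p' z"
    unfolding laurent_poly_def by blast
  have "f z * g z * z ^ (N + N') = poly (p * p') z" if "z \<noteq> 0" for z
    unfolding poly_mult fg[OF that, symmetric] by (simp add: power_add mult_ac)
  moreover have "coeff (p * p') i \<in> \<int>" for i
    unfolding coeff_mult by (intro Ints_sum Ints_mult p)
  ultimately show ?thesis by (intro laurent_polyI)
qed

lemma laurent_poly_add:
  assumes "laurent_poly f" "laurent_poly g"
  shows "laurent_poly (\<lambda>z. f z + g z)"
proof -
  from assms obtain N p N' p' where p: "\<And>i. coeff p i \<in> \<int>" "\<And>i. coeff p' i \<in> \<int>"
    and fg: "\<And>z. z \<noteq> 0 \<Longrightarrow> f z * z ^ N = poly p z" "\<And>z. z \<noteq> 0 \<Longrightarrow> g z * z ^ N' = poly p' z"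
    unfolding laurent_poly_def by blast
  have "(f z + g z) * z ^ (N + N') = poly (monom 1 N' * p + monom 1 N * p') z" if "z \<noteq> 0" for z
    unfolding poly_mult poly_add fg[OF that, symmetric]
    by (simp add: power_add poly_monom algebra_simps)
  moreover have "coeff (monom 1 N' * p + monom 1 N * p') i \<in> \<int>" for i
    by (simp add: coeff_monom_mult p)
  ultimately show ?thesis by (intro laurent_polyI)
qed

lemma laurent_poly_sum:
  "(\<And>i. i \<in> A \<Longrightarrow> laurent_poly (f i)) \<Longrightarrow> laurent_poly (\<lambda>z. \<Sum>i\<in>A. f i z)"
  by (induction A rule: infinite_finite_induct) (auto intro: laurent_poly_const laurent_poly_add)

lemma laurent_poly_expansion:
  assumes "laurent_poly f"
  obtains M :: "int \<Rightarrow> int" where "finite {m. M m \<noteq> 0}"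
    "\<And>z. z \<noteq> 0 \<Longrightarrow> f z = (\<Sum>m\<in>{m. M m \<noteq> 0}. of_int (M m) * z powi m)"
proof -
  from assms obtain N p where p: "\<And>i. coeff p i \<in> \<int>" "\<And>z. z \<noteq> 0 \<Longrightarrow> f z * z ^ N = poly p z"
    unfolding laurent_poly_def by blast
  then have "\<forall>i. \<exists>c. coeff p i = of_int c" by (meson Ints_cases)
  then obtain c where c: "\<And>i. coeff p i = of_int (c i)" by metis
  \<comment> \<open>Dividing by \<open>z ^ N\<close> shifts exponents: the coefficient of
    \<open>z powi m\<close> is that of index \<open>m + N\<close> in \<open>p\<close>.\<close>
  define M where "M m = (if m + int N \<ge> 0 then c (nat (m + int N)) else 0)" for m
  have sub: "{m. M m \<noteq> 0} \<subseteq> (\<lambda>i. int i - int N) ` {..degree p}"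
  proof
    fix m assume "m \<in> {m. M m \<noteq> 0}"
    then have m: "m + int N \<ge> 0" "c (nat (m + int N)) \<noteq> 0" by (auto simp: M_def split: if_splits)
    then have "nat (m + int N) \<le> degree p" by (intro le_degree) (simp add: c)
    with m show "m \<in> (\<lambda>i. int i - int N) ` {..degree p}"
      by (intro image_eqI[of _ _ "nat (m + int N)"]) auto
  qed
  show thesis
  proof (rule that)
    show "finite {m. M m \<noteq> 0}" using sub finite_subset by blast
    fix z :: complex assume z: "z \<noteq> 0"
    have "f z = (\<Sum>i\<le>degree p. coeff p i * z ^ i) / z ^ N"
      using p(2)[OF z] z by (simp add: poly_altdef field_simps)
    also have "\<dots> = (\<Sum>i\<le>degree p. of_int (M (int i - int N)) * z powi (int i - int N))"
      using z by (simp add: sum_divide_distrib c M_def power_int_diff)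
    also have "\<dots> = (\<Sum>m\<in>(\<lambda>i. int i - int N) ` {..degree p}. of_int (M m) * z powi m)"
      by (subst sum.reindex) (auto simp: inj_on_def)
    also have "\<dots> = (\<Sum>m\<in>{m. M m \<noteq> 0}. of_int (M m) * z powi m)"
      using sub by (intro sum.mono_neutral_right) auto
    finally show "f z = (\<Sum>m\<in>{m. M m \<noteq> 0}. of_int (M m) * z powi m)" .
  qed
qed

text \<open>The difference, multiplied by a power of \<open>z\<close>, is a polynomial vanishing at
  every nonzero point, hence zero. This is the uniqueness needed for the definite description in
  \<open>Mbar\<close>.\<close>

lemma laurent_expansion_unique:
  fixes M M' :: "int \<Rightarrow> int"
  assumes fin: "finite {m. M m \<noteq> 0}" "finite {m. M' m \<noteq> 0}"
    and eq: "\<And>z::complex. z \<noteq> 0 \<Longrightarrow> (\<Sum>m\<in>{m. M m \<noteq> 0}. of_int (M m) * z powi m) =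
       (\<Sum>m\<in>{m. M' m \<noteq> 0}. of_int (M' m) * z powi m)"
  shows "M = M'"
proof
  fix m0
  \<comment> \<open>Including \<open>m0\<close> lets its coefficient be read off even if both
    functions vanish there.\<close>
  define S where "S = insert m0 ({m. M m \<noteq> 0} \<union> {m. M' m \<noteq> 0})"
  define D :: "int \<Rightarrow> complex" where "D m = of_int (M m - M' m)" for m
  have S: "finite S" using fin by (simp add: S_def)
  define N where "N = nat (- Min S)"
  have N: "m + int N \<ge> 0" if "m \<in> S" for m
    using Min_le[OF S that] by (simp add: N_def)
  define p where "p = (\<Sum>m\<in>S. monom (D m) (nat (m + int N)))"
  have "poly p z = 0" if z: "z \<noteq> 0" for z
  proof -
    have "poly p z = (\<Sum>m\<in>S. z ^ N * (D m * z powi m))"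
      unfolding p_def poly_sum
    proof (intro sum.cong refl)
      fix m assume "m \<in> S"
      then have "z ^ nat (m + int N) = z powi (m + int N)"
        using N by (simp add: power_int_def)
      then show "poly (monom (D m) (nat (m + int N))) z = z ^ N * (D m * z powi m)"
        using z by (simp add: poly_monom power_int_add)
    qed
    also have "\<dots> = z ^ N * ((\<Sum>m\<in>S. of_int (M m) * z powi m) - (\<Sum>m\<in>S. of_int (M' m) * z powi m))"
      by (simp add: D_def sum_distrib_left sum_subtractf[symmetric] algebra_simps)
    also have "(\<Sum>m\<in>S. of_int (M m) * z powi m) = (\<Sum>m\<in>{m. M m \<noteq> 0}. of_int (M m) * z powi m)"
      using S by (intro sum.mono_neutral_right) (auto simp: S_def)
    also have "(\<Sum>m\<in>S. of_int (M' m) * z powi m) = (\<Sum>m\<in>{m. M' m \<noteq> 0}. of_int (M' m) * z powi m)"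
      using S by (intro sum.mono_neutral_right) (auto simp: S_def)
    finally show ?thesis using eq[OF z] by simp
  qed
  then have "UNIV - {0} \<subseteq> {z. poly p z = 0}" by auto
  moreover have "infinite (UNIV - {0 :: complex})"
    by (simp add: infinite_UNIV_char_0)
  ultimately have "p = 0"
    using poly_roots_finite finite_subset by blast
  then have "0 = coeff p (nat (m0 + int N))" by simp
  also have "\<dots> = (\<Sum>m\<in>S. if m = m0 then D m else 0)"
    unfolding p_def coeff_sum
  proof (intro sum.cong refl)
    fix m assume "m \<in> S"
    then show "coeff (monom (D m) (nat (m + int N))) (nat (m0 + int N)) = (if m = m0 then D m else 0)"
      using N[of m] N[of m0] by (auto simp: S_def nat_eq_iff)
  qed
  also have "\<dots> = D m0" using S by (simp add: S_def)
  finally show "M m0 = M' m0" by (simp add: D_def)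
qed

section \<open>Power series whose coefficients are Laurent polynomials in z\<close>

definition laurent_coeffs :: "(complex \<Rightarrow> complex fps) \<Rightarrow> bool" where
  "laurent_coeffs F \<longleftrightarrow> (\<forall>n. laurent_poly (\<lambda>z. F z $ n))"

lemma laurent_coeffs_X_power: "laurent_coeffs (\<lambda>z. fps_X ^ k)"
  unfolding laurent_coeffs_def by (auto intro: laurent_poly_const)

lemma laurent_coeffs_1: "laurent_coeffs (\<lambda>z. 1)"
  using laurent_coeffs_X_power[of 0] by simp

lemma laurent_coeffs_const:
  assumes "laurent_poly c"
  shows "laurent_coeffs (\<lambda>z. fps_const (c z))"
  unfolding laurent_coeffs_def
proof
  show "laurent_poly (\<lambda>z. fps_const (c z) $ n)" for n
    using assms by (cases "n = 0") (auto intro: laurent_poly_const)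
qed

lemma laurent_coeffs_mult:
  "laurent_coeffs F \<Longrightarrow> laurent_coeffs G \<Longrightarrow> laurent_coeffs (\<lambda>z. F z * G z)"
  unfolding laurent_coeffs_def fps_mult_nth by (auto intro!: laurent_poly_sum laurent_poly_mult)

lemma laurent_coeffs_add:
  "laurent_coeffs F \<Longrightarrow> laurent_coeffs G \<Longrightarrow> laurent_coeffs (\<lambda>z. F z + G z)"
  unfolding laurent_coeffs_def fps_add_nth by (auto intro!: laurent_poly_add)

lemma laurent_coeffs_diff:
  assumes "laurent_coeffs F" "laurent_coeffs G"
  shows "laurent_coeffs (\<lambda>z. F z - G z)"
proof -
  have "laurent_coeffs (\<lambda>z. fps_const (- 1))"
    by (intro laurent_coeffs_const laurent_poly_const) simp
  with assms have "laurent_coeffs (\<lambda>z. F z + fps_const (- 1) * G z)"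
    by (intro laurent_coeffs_add laurent_coeffs_mult)
  then show ?thesis by (simp flip: fps_const_neg)
qed

lemma laurent_coeffs_prod:
  "(\<And>k. k \<in> A \<Longrightarrow> laurent_coeffs (F k)) \<Longrightarrow> laurent_coeffs (\<lambda>z. \<Prod>k\<in>A. F k z)"
  by (induction A rule: infinite_finite_induct) (auto intro: laurent_coeffs_1 laurent_coeffs_mult)

text \<open>With constant term 1, the recursion for the coefficients of the inverse needs no
  division, so they remain integral Laurent polynomials.\<close>

lemma laurent_coeffs_inverse:
  assumes F: "laurent_coeffs F" and 0: "\<And>z. F z $ 0 = 1"
  shows "laurent_coeffs (\<lambda>z. inverse (F z))"
  unfolding laurent_coeffs_def
proof
  fix n
  show "laurent_poly (\<lambda>z. inverse (F z) $ n)"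
  proof (induction n rule: less_induct)
    case (less n)
    show ?case
    proof (cases "n = 0")
      case True
      then show ?thesis by (simp add: 0 laurent_poly_const)
    next
      case False
      have "inverse (F z) $ n = - 1 * (\<Sum>i<n. inverse (F z) $ i * F z $ (n - i))" for z
      proof -
        have "(inverse (F z) * F z) $ n = 0"
          using 0[of z] False by (simp add: inverse_mult_eq_1)
        moreover have "{0..n} = insert n {..<n}" by auto
        ultimately show ?thesis
          by (simp add: fps_mult_nth 0 eq_neg_iff_add_eq_0)
      qed
      moreover have "laurent_poly (\<lambda>z. - 1 * (\<Sum>i<n. inverse (F z) $ i * F z $ (n - i)))"
        using F less unfolding laurent_coeffs_def
        by (intro laurent_poly_mult laurent_poly_sum laurent_poly_const) auto
      ultimately show ?thesis by (simp only:)
    qed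
  qed
qed

lemma laurent_coeffs_crank_gf: "laurent_coeffs crank_gf"
  unfolding laurent_coeffs_def
proof
  fix n
  have "laurent_coeffs (\<lambda>z. \<Prod>k\<in>{1..n}. crank_factor z k)"
    by (intro laurent_coeffs_prod laurent_coeffs_mult laurent_coeffs_inverse laurent_coeffs_add
          laurent_coeffs_diff laurent_coeffs_1 laurent_coeffs_X_power laurent_coeffs_const
          laurent_poly_id laurent_poly_inverse crank_denom_nth_0) simp
  then show "laurent_poly (\<lambda>z. crank_gf z $ n)"
    by (simp add: laurent_coeffs_def crank_gf_def fps_prodinf_def)
qed

text \<open>The defining condition of \<open>Mbar\<close> constrains each \<open>n\<close>
  separately: existence comes from the Laurent polynomial coefficients, assembled by choice, and
  uniqueness from \<open>laurent_expansion_unique\<close>.\<close>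

lemma Mbar_expansion:
  assumes "z \<noteq> 0"
  shows "(\<Sum>m\<in>{m. Mbar m n \<noteq> 0}. of_int (Mbar m n) * z powi m) = crank_gf z $ n"
proof -
  define Q :: "nat \<Rightarrow> (int \<Rightarrow> int) \<Rightarrow> bool" where "Q n M \<longleftrightarrow> finite {m. M m \<noteq> 0} \<and>
      (\<forall>z. z \<noteq> 0 \<longrightarrow> crank_gf z $ n = (\<Sum>m\<in>{m. M m \<noteq> 0}. of_int (M m) * z powi m))" for n M
  have "\<exists>M. Q n M" for n
  proof -
    have "laurent_poly (\<lambda>z. crank_gf z $ n)"
      using laurent_coeffs_crank_gf by (simp add: laurent_coeffs_def)
    then show ?thesis
      by (rule laurent_poly_expansion) (unfold Q_def, blast)
  qed
  then have "\<exists>M. \<forall>n. Q n (M n)"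
    by (intro choice allI)
  then obtain M where M: "\<And>n. Q n (M n)"
    by blast
  have unique: "M' = M''" if "Q n M'" "Q n M''" for n M' M''
    using that unfolding Q_def by (intro laurent_expansion_unique) auto
  have "Mbar = (THE M. \<forall>n. Q n (\<lambda>m. M m n))"
    by (simp only: Mbar_def Q_def)
  also have "\<dots> = (\<lambda>m n. M n m)"
  proof (rule the_equality)
    show "\<forall>n. Q n (\<lambda>m. M n m)" using M by simp
    fix M' assume "\<forall>n. Q n (\<lambda>m. M' m n)"
    then have "(\<lambda>m. M' m n) = M n" for n
      using M unique by blast
    then show "M' = (\<lambda>m n. M n m)" by (auto simp: fun_eq_iff)
  qed
  finally have Mbar: "Mbar = (\<lambda>m n. M n m)" .
  have "(\<lambda>m. Mbar m n) = M n"
    by (rule ext) (rule fun_cong[OF fun_cong[OF Mbar]])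
  with M[of n] have "Q n (\<lambda>m. Mbar m n)" by argo
  with assms show ?thesis by (simp add: Q_def)
qed

theorem theorem2p9:
  fixes \<zeta> :: complex
  assumes "\<zeta> ^ 3 = 1" and "\<zeta> \<noteq> 1"
  shows "Abs_fps (\<lambda>n. \<Sum>m\<in>{m. Mbar m n \<noteq> 0}. of_int (Mbar m n) * \<zeta> powi m)
       = fps_compose M03 (fps_X ^ 3) + fps_X * fps_compose M13 (fps_X ^ 3)
         + fps_X ^ 2 * fps_compose M23 (fps_X ^ 3)"
proof -
  have "\<zeta> \<noteq> 0" using assms(1) by auto
  then have "Abs_fps (\<lambda>n. \<Sum>m\<in>{m. Mbar m n \<noteq> 0}. of_int (Mbar m n) * \<zeta> powi m) = crank_gf \<zeta>"
    by (simp add: Mbar_expansion fps_nth_inverse)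
  also have "\<dots> = qinf 1 * qinf 2 * inverse (qinf 3)"
    using assms by (rule crank_gf_cube_root)
  \<comment> \<open>Substituting \<open>q^3\<close> turns \<open>qinf a\<close> into
    \<open>qinf (3 * a)\<close>, so the indices 1, 2, 3, 6 of the components become the 3, 6, 9, 18
    of the dissection.\<close>
  finally show ?thesis
    unfolding qinf_dissection M03_def M13_def M23_def
    by (simp add: fps_compose_mult_distrib fps_compose_uminus fps_inverse_compose
          fps_compose_power[symmetric] qinf_compose)
qed

end
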